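(* Define $r_4=7$ and, for $n\ge 5$, $$r_n=r_{n-1}+\frac{(n-1)!}{2}+(n-1)!\left(\sum_{l=3}^{n-2}\frac{(l-1)^2}{l!}\right)+(n-3)(n-1).$$ Then for every $n\ge 5$ the rank of $PT_n$ is at most $r_n$.
   Context: For an integer $n\ge 2$, the twin group $T_n$ is the group generated by $s_1,\dots,s_{n-1}$ with defining relations $s_i^2=1$ for $1\le i\le n-1$ and $s_is_j=s_js_i$ for $|i-j|\ge 2$. The pure twin group $PT_n$ is the kernel of the homomorphism $\pi:T_n\to S_n$ to the symmetric group on $\{1,\dots,n\}$ that maps $s_i$ to the transposition $(i,i+1)$. The rank of a group is the minimal number of elements in a generating set. *)

theory Defs
  imports "HOL-Algebra.Sym_Groups" "HOL-Library.Extended_Real"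
begin

section \<open>Groups given by generators and relations\<close>

text \<open>A letter \<open>(x, True)\<close> stands for the generator \<open>x\<close>, and \<open>(x, False)\<close> for its formal inverse.
  Relations are pairs of words.\<close>

type_synonym 'a gword = "('a \<times> bool) list"

inductive_set pres_cong :: "'a set \<Rightarrow> ('a gword \<times> 'a gword) set \<Rightarrow> ('a gword \<times> 'a gword) set"
  for X :: "'a set" and R :: "('a gword \<times> 'a gword) set" where
  refl: "w \<in> lists (X \<times> UNIV) \<Longrightarrow> (w, w) \<in> pres_cong X R"
| sym: "(v, w) \<in> pres_cong X R \<Longrightarrow> (w, v) \<in> pres_cong X R"
| trans: "(u, v) \<in> pres_cong X R \<Longrightarrow> (v, w) \<in> pres_cong X R \<Longrightarrow> (u, w) \<in> pres_cong X R"
| cancel: "u \<in> lists (X \<times> UNIV) \<Longrightarrow> v \<in> lists (X \<times> UNIV) \<Longrightarrow> x \<in> X \<Longrightarrow>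
    (u @ [(x, b), (x, \<not> b)] @ v, u @ v) \<in> pres_cong X R"
| rel: "u \<in> lists (X \<times> UNIV) \<Longrightarrow> v \<in> lists (X \<times> UNIV) \<Longrightarrow> (l, r) \<in> R \<Longrightarrow>
    (u @ l @ v, u @ r @ v) \<in> pres_cong X R"

definition presented_group :: "'a set \<Rightarrow> ('a gword \<times> 'a gword) set \<Rightarrow> 'a gword set monoid" where
  "presented_group X R =
    \<lparr>carrier = lists (X \<times> UNIV) // pres_cong X R,
     monoid.mult = (\<lambda>A B. \<Union>a\<in>A. \<Union>b\<in>B. pres_cong X R `` {a @ b}),
     one = pres_cong X R `` {[]}\<rparr>"

definition pres_gen :: "'a set \<Rightarrow> ('a gword \<times> 'a gword) set \<Rightarrow> 'a \<Rightarrow> 'a gword set" where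
  "pres_gen X R x = pres_cong X R `` {[(x, True)]}"

fun eval_word :: "('b, 'c) monoid_scheme \<Rightarrow> ('a \<Rightarrow> 'b) \<Rightarrow> 'a gword \<Rightarrow> 'b" where
  "eval_word G f [] = \<one>\<^bsub>G\<^esub>"
| "eval_word G f ((x, b) # w) = (if b then f x else inv\<^bsub>G\<^esub> (f x)) \<otimes>\<^bsub>G\<^esub> eval_word G f w"

text \<open>The map out of a presented group induced by a map on the generators; it is meaningful when
  the latter respects the relations (see \<open>pres_lift_hom\<close> below).\<close>

definition pres_lift :: "('b, 'c) monoid_scheme \<Rightarrow> ('a \<Rightarrow> 'b) \<Rightarrow> 'a gword set \<Rightarrow> 'b" where
  "pres_lift G f A = the_elem (eval_word G f ` A)"

lemma pres_cong_in_lists: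
  assumes R: "R \<subseteq> lists (X \<times> UNIV) \<times> lists (X \<times> UNIV)"
    and "(v, w) \<in> pres_cong X R"
  shows "v \<in> lists (X \<times> UNIV) \<and> w \<in> lists (X \<times> UNIV)"
  using assms(2) by (induction rule: pres_cong.induct) (use R in auto)

lemma pres_cong_equiv:
  assumes R: "R \<subseteq> lists (X \<times> UNIV) \<times> lists (X \<times> UNIV)"
  shows "equiv (lists (X \<times> UNIV)) (pres_cong X R)"
proof (rule equivI)
  show "pres_cong X R \<subseteq> lists (X \<times> UNIV) \<times> lists (X \<times> UNIV)"
    using pres_cong_in_lists[OF R] by (intro subrelI) blast
  show "refl_on (lists (X \<times> UNIV)) (pres_cong X R)"
    using pres_cong.refl by (auto simp: refl_on_def)
  show "Relation.sym (pres_cong X R)"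
    by (auto simp: sym_def intro: pres_cong.sym)
  show "Relation.trans (pres_cong X R)"
    by (auto simp: trans_def intro: pres_cong.trans)
qed

lemma pres_cong_append_left:
  assumes "(v, w) \<in> pres_cong X R" "u \<in> lists (X \<times> UNIV)"
  shows "(u @ v, u @ w) \<in> pres_cong X R"
  using assms
proof (induction rule: pres_cong.induct)
  case (cancel p q x b)
  then show ?case using pres_cong.cancel[of "u @ p" X q x b R] by simp
next
  case (rel p q l r)
  then show ?case using pres_cong.rel[of "u @ p" X q l r R] by simp
next
  case (refl w)
  then show ?case by (intro pres_cong.refl) auto
next
  case (sym v w)
  then show ?case by (blast intro: pres_cong.sym)
next
  case (trans u v w)
  then show ?case by (blast intro: pres_cong.trans)
qed

lemma pres_cong_append_right:
  assumes "(v, w) \<in> pres_cong X R" "u \<in> lists (X \<times> UNIV)"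
  shows "(v @ u, w @ u) \<in> pres_cong X R"
  using assms
proof (induction rule: pres_cong.induct)
  case (cancel p q x b)
  then show ?case using pres_cong.cancel[of p X "q @ u" x b R] by simp
next
  case (rel p q l r)
  then show ?case using pres_cong.rel[of p X "q @ u" l r R] by simp
next
  case (refl w)
  then show ?case by (intro pres_cong.refl) auto
next
  case (sym v w)
  then show ?case by (blast intro: pres_cong.sym)
next
  case (trans u v w)
  then show ?case by (blast intro: pres_cong.trans)
qed

lemma pres_cong_append:
  assumes R: "R \<subseteq> lists (X \<times> UNIV) \<times> lists (X \<times> UNIV)"
    and "(v, v') \<in> pres_cong X R" "(w, w') \<in> pres_cong X R"
  shows "(v @ w, v' @ w') \<in> pres_cong X R"
proof (rule pres_cong.trans)
  show "(v @ w, v' @ w) \<in> pres_cong X R"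
    using pres_cong_append_right[OF assms(2)] pres_cong_in_lists[OF R assms(3)] by simp
  show "(v' @ w, v' @ w') \<in> pres_cong X R"
    using pres_cong_append_left[OF assms(3)] pres_cong_in_lists[OF R assms(2)] by simp
qed

lemma presented_group_mult:
  assumes R: "R \<subseteq> lists (X \<times> UNIV) \<times> lists (X \<times> UNIV)"
    and v: "v \<in> lists (X \<times> UNIV)" and w: "w \<in> lists (X \<times> UNIV)"
  shows "pres_cong X R `` {v} \<otimes>\<^bsub>presented_group X R\<^esub> pres_cong X R `` {w}
    = pres_cong X R `` {v @ w}"
proof -
  have "pres_cong X R `` {a @ b} = pres_cong X R `` {v @ w}"
    if "(v, a) \<in> pres_cong X R" "(w, b) \<in> pres_cong X R" for a b
    using equiv_class_eq[OF pres_cong_equiv[OF R] pres_cong_append[OF R that]] by simp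
  then have "(\<Union>a\<in>pres_cong X R `` {v}. \<Union>b\<in>pres_cong X R `` {w}. pres_cong X R `` {a @ b})
      = (\<Union>a\<in>pres_cong X R `` {v}. \<Union>b\<in>pres_cong X R `` {w}. pres_cong X R `` {v @ w})"
    by (intro SUP_cong HOL.refl) simp
  also have "\<dots> = pres_cong X R `` {v @ w}"
    using pres_cong.refl[OF v, of R] pres_cong.refl[OF w, of R] by (intro equalityI) blast+
  finally show ?thesis
    by (simp add: presented_group_def)
qed

lemma presented_group_carrierE:
  assumes "A \<in> carrier (presented_group X R)"
  obtains w where "w \<in> lists (X \<times> UNIV)" "A = pres_cong X R `` {w}"
proof -
  have "A \<in> lists (X \<times> UNIV) // pres_cong X R"
    using assms by (simp add: presented_group_def)
  then show thesis
    by (rule quotientE) (rule that)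
qed

lemma presented_group_classI:
  "w \<in> lists (X \<times> UNIV) \<Longrightarrow> pres_cong X R `` {w} \<in> carrier (presented_group X R)"
  by (simp add: presented_group_def quotientI)

lemma presented_group_is_group:
  assumes R: "R \<subseteq> lists (X \<times> UNIV) \<times> lists (X \<times> UNIV)"
  shows "group (presented_group X R)"
proof (rule groupI)
  let ?P = "presented_group X R"
  have one: "\<one>\<^bsub>?P\<^esub> = pres_cong X R `` {[]}"
    by (simp add: presented_group_def)
  note mult = presented_group_mult[OF R]
  show "\<one>\<^bsub>?P\<^esub> \<in> carrier ?P"
    unfolding one by (rule presented_group_classI) simp
  fix x assume "x \<in> carrier ?P"
  then obtain u where u: "u \<in> lists (X \<times> UNIV)" "x = pres_cong X R `` {u}"
    by (rule presented_group_carrierE)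
  show "\<one>\<^bsub>?P\<^esub> \<otimes>\<^bsub>?P\<^esub> x = x"
    unfolding one u(2) using mult[OF lists.Nil u(1)] by simp
  have "\<exists>w\<in>lists (X \<times> UNIV). (w @ u, []) \<in> pres_cong X R"
    using u(1)
  proof (induction u)
    case Nil
    show ?case by (rule bexI[of _ "[]"]) (auto intro: pres_cong.refl)
  next
    case (Cons a u)
    then obtain w where w: "w \<in> lists (X \<times> UNIV)" "(w @ u, []) \<in> pres_cong X R"
      by blast
    obtain y b where a: "a = (y, b)" "y \<in> X"
      using Cons by (cases a) auto
    have "((w @ [(y, \<not> b)]) @ a # u, w @ u) \<in> pres_cong X R"
      using pres_cong.cancel[of w X u y "\<not> b" R] w Cons a by simp
    then have "((w @ [(y, \<not> b)]) @ a # u, []) \<in> pres_cong X R"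
      using w(2) by (rule pres_cong.trans)
    moreover have "w @ [(y, \<not> b)] \<in> lists (X \<times> UNIV)"
      using w a by simp
    ultimately show ?case by blast
  qed
  then obtain w where w: "w \<in> lists (X \<times> UNIV)" "(w @ u, []) \<in> pres_cong X R" by blast
  have "pres_cong X R `` {w} \<otimes>\<^bsub>?P\<^esub> x = \<one>\<^bsub>?P\<^esub>"
    unfolding u(2) one mult[OF w(1) u(1)]
    by (rule equiv_class_eq[OF pres_cong_equiv[OF R] w(2)])
  then show "\<exists>y\<in>carrier ?P. y \<otimes>\<^bsub>?P\<^esub> x = \<one>\<^bsub>?P\<^esub>"
    using presented_group_classI[OF w(1)] by blast
  fix y assume "y \<in> carrier ?P"
  then obtain v where v: "v \<in> lists (X \<times> UNIV)" "y = pres_cong X R `` {v}"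
    by (rule presented_group_carrierE)
  have uv: "u @ v \<in> lists (X \<times> UNIV)" using u v by simp
  show "x \<otimes>\<^bsub>?P\<^esub> y \<in> carrier ?P"
    unfolding u(2) v(2) mult[OF u(1) v(1)] by (rule presented_group_classI[OF uv])
  fix z assume "z \<in> carrier ?P"
  then obtain w where w: "w \<in> lists (X \<times> UNIV)" "z = pres_cong X R `` {w}"
    by (rule presented_group_carrierE)
  have vw: "v @ w \<in> lists (X \<times> UNIV)" using v w by simp
  show "x \<otimes>\<^bsub>?P\<^esub> y \<otimes>\<^bsub>?P\<^esub> z = x \<otimes>\<^bsub>?P\<^esub> (y \<otimes>\<^bsub>?P\<^esub> z)"
    unfolding u(2) v(2) w(2) mult[OF u(1) v(1)] mult[OF v(1) w(1)] mult[OF uv w(1)]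
      mult[OF u(1) vw] by simp
qed

lemma (in group) eval_word_closed:
  assumes "f ` X \<subseteq> carrier G" "w \<in> lists (X \<times> UNIV)"
  shows "eval_word G f w \<in> carrier G"
  using assms(2)
proof (induction w)
  case Nil
  show ?case by simp
next
  case (Cons a w)
  obtain x b where a: "a = (x, b)" "x \<in> X"
    using Cons(1) by (cases a) simp
  then have "f x \<in> carrier G" using assms(1) by blast
  then show ?case
    using Cons(3) by (simp add: a(1))
qed

lemma (in group) eval_word_append:
  assumes "f ` X \<subseteq> carrier G" "v \<in> lists (X \<times> UNIV)" "w \<in> lists (X \<times> UNIV)"
  shows "eval_word G f (v @ w) = eval_word G f v \<otimes> eval_word G f w"
  using assms(2)
proof (induction v)
  case Nil
  then show ?case using eval_word_closed[OF assms(1,3)] by simp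
next
  case (Cons a v)
  obtain x b where a: "a = (x, b)" "x \<in> X"
    using Cons(1) by (cases a) simp
  then have "f x \<in> carrier G" using assms(1) by blast
  then show ?case
    using Cons(3) eval_word_closed[OF assms(1,3)] eval_word_closed[OF assms(1) Cons(2)]
    by (simp add: a(1) m_assoc)
qed

lemma (in group) eval_word_cong:
  assumes R: "R \<subseteq> lists (X \<times> UNIV) \<times> lists (X \<times> UNIV)"
    and f: "f ` X \<subseteq> carrier G"
    and resp: "\<And>l r. (l, r) \<in> R \<Longrightarrow> eval_word G f l = eval_word G f r"
    and "(v, w) \<in> pres_cong X R"
  shows "eval_word G f v = eval_word G f w"
  using assms(4)
proof (induction rule: pres_cong.induct)
  case (cancel u v x b)
  have fx: "f x \<in> carrier G" using f cancel(3) by blast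
  have v: "eval_word G f v \<in> carrier G" by (rule eval_word_closed[OF f cancel(2)])
  have xx: "[(x, b), (x, \<not> b)] @ v \<in> lists (X \<times> UNIV)"
    using cancel by simp
  have "eval_word G f ([(x, b), (x, \<not> b)] @ v) = eval_word G f v"
    using fx v by (cases b) (simp_all add: m_assoc[symmetric])
  then show ?case
    unfolding eval_word_append[OF f cancel(1) xx] eval_word_append[OF f cancel(1,2)] by simp
next
  case (rel u v l r)
  have l: "l \<in> lists (X \<times> UNIV)" and r: "r \<in> lists (X \<times> UNIV)"
    using rel(3) R by blast+
  have lv: "l @ v \<in> lists (X \<times> UNIV)" and rv: "r @ v \<in> lists (X \<times> UNIV)"
    using l r rel(2) by simp_all
  show ?case
    unfolding eval_word_append[OF f rel(1) lv] eval_word_append[OF f rel(1) rv]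
      eval_word_append[OF f l rel(2)] eval_word_append[OF f r rel(2)] resp[OF rel(3)] ..
qed simp_all

lemma (in group) pres_lift_class:
  assumes R: "R \<subseteq> lists (X \<times> UNIV) \<times> lists (X \<times> UNIV)"
    and f: "f ` X \<subseteq> carrier G"
    and resp: "\<And>l r. (l, r) \<in> R \<Longrightarrow> eval_word G f l = eval_word G f r"
    and w: "w \<in> lists (X \<times> UNIV)"
  shows "pres_lift G f (pres_cong X R `` {w}) = eval_word G f w"
proof -
  have "w \<in> pres_cong X R `` {w}" using pres_cong.refl[OF w] by simp
  moreover have "eval_word G f v = eval_word G f w" if "v \<in> pres_cong X R `` {w}" for v
    using eval_word_cong[OF R f resp, of w v] that by simp
  ultimately have "eval_word G f ` (pres_cong X R `` {w}) = {eval_word G f w}"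
    by (metis (no_types, lifting) empty_iff image_constant image_cong)
  then show ?thesis by (simp add: pres_lift_def)
qed

lemma (in group) pres_lift_hom:
  assumes R: "R \<subseteq> lists (X \<times> UNIV) \<times> lists (X \<times> UNIV)"
    and f: "f ` X \<subseteq> carrier G"
    and resp: "\<And>l r. (l, r) \<in> R \<Longrightarrow> eval_word G f l = eval_word G f r"
  shows "pres_lift G f \<in> hom (presented_group X R) G"
proof (rule homI)
  have lift: "pres_lift G f (pres_cong X R `` {w}) = eval_word G f w"
    if "w \<in> lists (X \<times> UNIV)" for w
    by (rule pres_lift_class[OF R f resp that])
  fix A assume "A \<in> carrier (presented_group X R)"
  then obtain v where v: "v \<in> lists (X \<times> UNIV)" "A = pres_cong X R `` {v}"
    by (rule presented_group_carrierE)
  show "pres_lift G f A \<in> carrier G"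
    unfolding v(2) lift[OF v(1)] by (rule eval_word_closed[OF f v(1)])
  fix B assume "B \<in> carrier (presented_group X R)"
  then obtain w where w: "w \<in> lists (X \<times> UNIV)" "B = pres_cong X R `` {w}"
    by (rule presented_group_carrierE)
  have vw: "v @ w \<in> lists (X \<times> UNIV)" using v w by simp
  show "pres_lift G f (A \<otimes>\<^bsub>presented_group X R\<^esub> B) = pres_lift G f A \<otimes> pres_lift G f B"
    unfolding v(2) w(2) presented_group_mult[OF R v(1) w(1)] lift[OF v(1)] lift[OF w(1)]
      lift[OF vw] by (rule eval_word_append[OF f v(1) w(1)])
qed

lemma (in group) pres_lift_gen:
  assumes R: "R \<subseteq> lists (X \<times> UNIV) \<times> lists (X \<times> UNIV)"
    and f: "f ` X \<subseteq> carrier G"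
    and resp: "\<And>l r. (l, r) \<in> R \<Longrightarrow> eval_word G f l = eval_word G f r"
    and x: "x \<in> X"
  shows "pres_lift G f (pres_gen X R x) = f x"
proof -
  have "pres_lift G f (pres_cong X R `` {[(x, True)]}) = eval_word G f [(x, True)]"
    using x by (intro pres_lift_class[OF R f resp]) simp_all
  also have "\<dots> = f x" using x f by auto
  finally show ?thesis by (simp add: pres_gen_def)
qed


section \<open>Twin groups\<close>

definition twin_rels :: "nat \<Rightarrow> (nat gword \<times> nat gword) set" where
  "twin_rels n =
    {([(i, True), (i, True)], []) | i. i \<in> {1..<n}} \<union>
    {([(i, True), (j, True)], [(j, True), (i, True)]) | i j.
       i \<in> {1..<n} \<and> j \<in> {1..<n} \<and> \<bar>int i - int j\<bar> \<ge> 2}"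

definition twin_group :: "nat \<Rightarrow> nat gword set monoid" where
  "twin_group n = presented_group {1..<n} (twin_rels n)"

definition twin_gen :: "nat \<Rightarrow> nat \<Rightarrow> nat gword set" where
  "twin_gen n i = pres_gen {1..<n} (twin_rels n) i"

definition twin_perm :: "nat \<Rightarrow> nat gword set \<Rightarrow> nat \<Rightarrow> nat" where
  "twin_perm n = pres_lift (sym_group n) (\<lambda>i. transpose i (i + 1))"

definition pure_twin_group :: "nat \<Rightarrow> nat gword set monoid" where
  "pure_twin_group n =
    (twin_group n)\<lparr>carrier := kernel (twin_group n) (sym_group n) (twin_perm n)\<rparr>"

lemma twin_rels_in_lists:
  "twin_rels n \<subseteq> lists ({1..<n} \<times> UNIV) \<times> lists ({1..<n} \<times> UNIV)"
  by (auto simp: twin_rels_def)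

lemma twin_group_is_group: "group (twin_group n)"
  unfolding twin_group_def by (rule presented_group_is_group[OF twin_rels_in_lists])

lemma transpose_in_sym_group:
  "(\<lambda>i. transpose i (i + 1)) ` {1..<n} \<subseteq> carrier (sym_group n)"
  by (auto simp: sym_group_def intro!: permutes_swap_id)

lemma twin_rels_respected:
  assumes "(l, r) \<in> twin_rels n"
  shows "eval_word (sym_group n) (\<lambda>i. transpose i (i + 1)) l
    = eval_word (sym_group n) (\<lambda>i. transpose i (i + 1)) r"
proof -
  have "transpose i (i + 1) \<circ> transpose j (j + 1) = transpose j (j + 1) \<circ> transpose i (i + 1)"
    if "\<bar>int i - int j\<bar> \<ge> 2" for i j :: nat
    using that by (auto simp: fun_eq_iff transpose_def)
  then show ?thesis
    using assms unfolding twin_rels_def by (auto simp: sym_group_def)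
qed

lemma twin_perm_hom: "twin_perm n \<in> hom (twin_group n) (sym_group n)"
  unfolding twin_perm_def twin_group_def
  by (rule group.pres_lift_hom[OF sym_group_is_group twin_rels_in_lists
        transpose_in_sym_group twin_rels_respected])

lemma twin_perm_gen:
  assumes "i \<in> {1..<n}"
  shows "twin_perm n (twin_gen n i) = transpose i (i + 1)"
  unfolding twin_perm_def twin_gen_def
  by (rule group.pres_lift_gen[OF sym_group_is_group twin_rels_in_lists
        transpose_in_sym_group twin_rels_respected assms])

lemma pure_twin_group_is_group: "group (pure_twin_group n)"
proof -
  interpret group_hom "twin_group n" "sym_group n" "twin_perm n"
    by (simp add: group_hom_def group_hom_axioms_def twin_group_is_group sym_group_is_group
        twin_perm_hom)
  show ?thesis
    unfolding pure_twin_group_def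
    using subgroup.subgroup_is_group[OF subgroup_kernel twin_group_is_group] .
qed


section \<open>Rank\<close>

text \<open>The rank is \<open>\<infinity>\<close> for groups that are not finitely generated.\<close>

definition group_rank :: "('a, 'b) monoid_scheme \<Rightarrow> enat" where
  "group_rank G =
    (INF S \<in> {S. finite S \<and> S \<subseteq> carrier G \<and> generate G S = carrier G}. enat (card S))"

end

theory Submission
  imports Defs
begin

text \<open>Let \<open>T m\<close> be generated by \<open>s\<^sub>1, \<dots>, s\<^bsub>m-1\<^esub>\<close> inside \<open>T\<^sub>N\<close>, let \<open>P m\<close> be its pure part, and let
  \<open>c\<^sub>p = s\<^sub>m s\<^bsub>m-1\<^esub> \<dots> s\<^sub>p\<close>. With \<open>z\<^sub>j = c\<^bsub>j+2\<^esub> (s\<^bsub>j+1\<^esub> s\<^sub>j)\<^sup>3 c\<^bsub>j+2\<^esub>\<^sup>-\<^sup>1\<close> one has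
  \<open>c\<^sub>p s\<^bsub>j+1\<^esub> = z\<^sub>j s\<^sub>j c\<^sub>p\<close> for \<open>p \<le> j < m\<close>, so a Schreier argument with coset representatives
  \<open>t c\<^sub>p\<close> shows that \<open>P (m + 1)\<close> is generated by \<open>P m\<close> and the conjugates of the \<open>z\<^sub>j\<close> by \<open>T m\<close>.
  As \<open>z\<^sub>j\<close> commutes with \<open>s\<^sub>1, \<dots>, s\<^bsub>j-2\<^esub>\<close> and is inverted by \<open>s\<^sub>j\<close>, only \<open>m! / (2 (j-1)!)\<close> conjugates
  are needed for each \<open>j\<close>. Their total number is at most the increment \<open>r\<^bsub>m+1\<^esub> - r\<^sub>m\<close> for \<open>m \<ge> 4\<close>, and
  the counts for \<open>m = 2, 3\<close> add up to \<open>r\<^sub>4 = 7\<close>.\<close>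

section \<open>Commutation and closure in generated subgroups\<close>

lemma (in group) commutes_generate:
  assumes x: "x \<in> carrier G" and A: "A \<subseteq> carrier G"
    and comm: "\<And>a. a \<in> A \<Longrightarrow> x \<otimes> a = a \<otimes> x" and y: "y \<in> generate G A"
  shows "x \<otimes> y = y \<otimes> x"
  using y
proof (induction rule: generate.induct)
  case one
  then show ?case using x by simp
next
  case (incl h)
  then show ?case by (rule comm)
next
  case (inv h)
  then have h: "h \<in> carrier G" "x \<otimes> h = h \<otimes> x" using A comm by auto
  have "x \<otimes> inv h = inv h \<otimes> (h \<otimes> x) \<otimes> inv h" using h(1) x by (simp add: m_assoc[symmetric])
  also have "\<dots> = inv h \<otimes> x" using h(1) x by (simp add: h(2)[symmetric] m_assoc)
  finally show ?case .
next
  case (eng h k)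
  then have "h \<in> carrier G" "k \<in> carrier G" using generate_in_carrier[OF A] by auto
  then show ?case using eng x by (metis m_assoc)
qed

text \<open>\<open>U\<close> need not be a subgroup; it may be a union of cosets. With
  \<open>u = \<one>\<close> this places the whole generated subgroup inside \<open>U\<close>, which
  is how it is used below.\<close>

lemma (in group) closed_under_generate:
  assumes A: "A \<subseteq> carrier G" and U: "U \<subseteq> carrier G"
    and step: "\<And>u a. u \<in> U \<Longrightarrow> a \<in> A \<Longrightarrow> u \<otimes> a \<in> U \<and> u \<otimes> inv a \<in> U"
    and x: "x \<in> generate G A" and u: "u \<in> U"
  shows "u \<otimes> x \<in> U"
  using x u
proof (induction arbitrary: u rule: generate.induct)
  case one
  then show ?case using U by (metis r_one subsetD)
next
  case (incl h)
  then show ?case using step by blast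
next
  case (inv h)
  then show ?case using step by blast
next
  case (eng h k)
  then have "h \<in> carrier G" "k \<in> carrier G" using generate_in_carrier[OF A] by auto
  then show ?case using eng U by (metis m_assoc subsetD)
qed

section \<open>Subgroups and descending products in a quotient of the twin group\<close>

locale twin_quotient = group G for G (structure) +
  fixes N :: nat and \<phi> :: "'a \<Rightarrow> nat \<Rightarrow> nat" and s :: "nat \<Rightarrow> 'a"
  assumes \<phi>_hom: "\<phi> \<in> hom G (sym_group N)"
    and s_closed: "i \<in> {1..<N} \<Longrightarrow> s i \<in> carrier G"
    and s_square: "i \<in> {1..<N} \<Longrightarrow> s i \<otimes> s i = \<one>"
    and s_comm: "i \<in> {1..<N} \<Longrightarrow> j \<in> {1..<N} \<Longrightarrow> i + 2 \<le> j \<Longrightarrow> s i \<otimes> s j = s j \<otimes> s i"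
    and \<phi>_s: "i \<in> {1..<N} \<Longrightarrow> \<phi> (s i) = transpose i (i + 1)"
begin

definition T :: "nat \<Rightarrow> 'a set" where "T m = generate G (s ` {1..<m})"
definition P :: "nat \<Rightarrow> 'a set" where "P m = {x \<in> T m. \<phi> x = id}"

text \<open>For \<open>1 \<le> p \<le> m + 1\<close>, \<open>c m p\<close> is the descending product
  \<open>s\<^bsub>m\<^esub> s\<^bsub>m-1\<^esub> \<dots> s\<^bsub>p\<^esub>\<close>, which moves the last of \<open>m + 1\<close> strands to position \<open>p\<close>.\<close>

fun c :: "nat \<Rightarrow> nat \<Rightarrow> 'a" where
  "c 0 p = \<one>"
| "c (Suc m) p = (if p \<le> Suc m then s (Suc m) \<otimes> c m p else \<one>)"

text \<open>For involutions a and b, (a b)^3 = 1 is the braid relation a b a = b a b. It holds for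
  adjacent transpositions but is not among the relations of the twin group, so the conjugated cube
  measures its failure.\<close>

definition z :: "nat \<Rightarrow> nat \<Rightarrow> 'a" where
  "z m j = c m (j + 2) \<otimes> ((s (j + 1) \<otimes> s j) [^] (3::nat)) \<otimes> inv (c m (j + 2))"

lemma \<phi>_group_hom: "group_hom G (sym_group N) \<phi>"
  by (simp add: group_hom_def group_hom_axioms_def is_group sym_group_is_group \<phi>_hom)

lemma \<phi>_mult: "x \<in> carrier G \<Longrightarrow> y \<in> carrier G \<Longrightarrow> \<phi> (x \<otimes> y) = \<phi> x \<circ> \<phi> y"
  using hom_mult[OF \<phi>_hom] by (simp add: sym_group_mult)

lemma \<phi>_one: "\<phi> \<one> = id"
  using group_hom.hom_one[OF \<phi>_group_hom] by (simp add: sym_group_one)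

lemma \<phi>_inv: assumes "x \<in> carrier G" shows "\<phi> (inv x) \<circ> \<phi> x = id" "\<phi> x \<circ> \<phi> (inv x) = id"
  using assms \<phi>_mult[of "inv x" x] \<phi>_mult[of x "inv x"] by (simp_all add: \<phi>_one)

lemma s_inv: "i \<in> {1..<N} \<Longrightarrow> inv (s i) = s i"
  using s_closed s_square by (simp add: inv_equality)

lemma s_cancel: "i \<in> {1..<N} \<Longrightarrow> x \<in> carrier G \<Longrightarrow> s i \<otimes> (s i \<otimes> x) = x"
  using s_closed s_square by (metis l_one m_assoc)

lemma s_image_carrier: "A \<subseteq> {1..<N} \<Longrightarrow> s ` A \<subseteq> carrier G"
  using s_closed by auto

lemma generate_s_mono: "A \<subseteq> B \<Longrightarrow> generate G (s ` A) \<subseteq> generate G (s ` B)"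
  by (intro mono_generate image_mono)

lemma T_subgroup: "m \<le> N \<Longrightarrow> subgroup (T m) G"
  unfolding T_def by (rule generate_is_subgroup, rule s_image_carrier) auto

lemma T_mono: "m \<le> m' \<Longrightarrow> T m \<subseteq> T m'"
  unfolding T_def by (intro generate_s_mono) auto

lemma s_in_T: "1 \<le> i \<Longrightarrow> i < m \<Longrightarrow> s i \<in> T m"
  unfolding T_def by (auto intro: generate.incl)

lemma T_carrier: "m \<le> N \<Longrightarrow> x \<in> T m \<Longrightarrow> x \<in> carrier G"
  using T_subgroup subgroup.mem_carrier by metis

lemma P_subgroup:
  assumes "m \<le> N" shows "subgroup (P m) G"
proof -
  have "P m = T m \<inter> kernel G (sym_group N) \<phi>"
    using T_carrier[OF assms] by (auto simp: P_def kernel_def sym_group_one)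
  then show ?thesis
    using subgroups_Inter_pair[OF T_subgroup[OF assms] group_hom.subgroup_kernel[OF \<phi>_group_hom]] by simp
qed

text \<open>Recording exactly which letters occur is what later yields commutation with distant
  generators.\<close>

lemma c_closed: "1 \<le> p \<Longrightarrow> m < N \<Longrightarrow> c m p \<in> generate G (s ` {p..m})"
proof (induction m)
  case 0
  then show ?case by (simp add: generate.one)
next
  case (Suc m)
  have "c m p \<in> generate G (s ` {p..Suc m})"
    using Suc generate_s_mono[of "{p..m}" "{p..Suc m}"] by auto
  then show ?case
    by (auto intro: generate.one intro!: generate.eng[OF generate.incl])
qed

lemma c_carrier: "1 \<le> p \<Longrightarrow> m < N \<Longrightarrow> c m p \<in> carrier G"
  using c_closed[of p m] generate_in_carrier[OF s_image_carrier[of "{p..m}"]] by fastforce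

lemma c_in_T: "1 \<le> p \<Longrightarrow> m < N \<Longrightarrow> c m p \<in> T (Suc m)"
  using c_closed[of p m] generate_s_mono[of "{p..m}" "{1..<Suc m}"] unfolding T_def
  by (auto simp: subset_iff)

lemma c_beyond: "m < p \<Longrightarrow> c m p = \<one>"
  by (cases m) auto

lemma c_split: "1 \<le> p \<Longrightarrow> p \<le> q \<Longrightarrow> q \<le> Suc m \<Longrightarrow> m < N \<Longrightarrow> c m p = c m q \<otimes> c (q - 1) p"
proof (induction m)
  case 0
  then show ?case by simp
next
  case (Suc m)
  show ?case
  proof (cases "q \<le> Suc m")
    case True
    then show ?thesis using Suc by (simp add: m_assoc s_closed c_carrier)
  next
    case False
    then have "q = Suc (Suc m)" using Suc by simp
    then show ?thesis using Suc c_carrier[of p "Suc m"] by simp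
  qed
qed

lemma c_Suc: "1 \<le> p \<Longrightarrow> p \<le> m \<Longrightarrow> m < N \<Longrightarrow> c m p = c m (Suc p) \<otimes> s p"
  using c_split[of p "Suc p" m] by (cases p) (auto simp: c_beyond s_closed)

lemma s_commutes:
  assumes "i \<in> {1..<N}" "A \<subseteq> {1..<N}" "\<And>a. a \<in> A \<Longrightarrow> i + 2 \<le> a \<or> a + 2 \<le> i"
    and "y \<in> generate G (s ` A)"
  shows "s i \<otimes> y = y \<otimes> s i"
proof (rule commutes_generate[OF _ _ _ assms(4)])
  show "s i \<in> carrier G" "s ` A \<subseteq> carrier G" using assms s_closed s_image_carrier by auto
  fix a assume "a \<in> s ` A"
  then obtain k where "a = s k" "k \<in> A" by blast
  then show "s i \<otimes> a = a \<otimes> s i"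
    using assms(1,2) assms(3)[of k] s_comm[of i k] s_comm[of k i] by auto
qed

lemma s_c_comm:
  assumes "i \<in> {1..<N}" "1 \<le> p" "m < N" "i + 2 \<le> p \<or> m + 2 \<le> i"
  shows "s i \<otimes> c m p = c m p \<otimes> s i"
  by (rule s_commutes[OF assms(1) _ _ c_closed[OF assms(2,3)]]) (use assms in auto)

text \<open>The rightmost factor acts first, so p climbs one place per factor. Hence the permutation
  of a representative determines p.\<close>

lemma \<phi>_c: "1 \<le> p \<Longrightarrow> p \<le> Suc m \<Longrightarrow> m < N \<Longrightarrow> \<phi> (c m p) p = Suc m"
proof (induction m)
  case 0
  then show ?case by (simp add: \<phi>_one)
next
  case (Suc m)
  then show ?case
    by (cases "p \<le> Suc m") (auto simp: \<phi>_mult \<phi>_one s_closed c_carrier \<phi>_s)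
qed

section \<open>Relations satisfied by the elements \<open>z m j\<close>\<close>

lemma z_factors_carrier:
  assumes "1 \<le> j" "j < m" "m < N"
  shows "c m (j + 2) \<in> carrier G" "s (j + 1) \<in> carrier G" "s j \<in> carrier G"
  using assms by (auto intro: c_carrier s_closed)

lemma z_in_P:
  assumes "1 \<le> j" "j < m" "m < N"
  shows "z m j \<in> P (Suc m)"
proof -
  note cl = z_factors_carrier[OF assms]
  interpret TS: subgroup "T (Suc m)" G using T_subgroup assms by simp
  have "c m (j + 2) \<in> T (Suc m)" "s (j + 1) \<in> T (Suc m)" "s j \<in> T (Suc m)"
    using assms by (auto intro: c_in_T s_in_T)
  then have "z m j \<in> T (Suc m)" unfolding z_def by (simp add: numeral_3_eq_3)
  \<comment> \<open>Two overlapping adjacent transpositions multiply to a 3-cycle, whose cube is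
    trivial.\<close>
  moreover have "\<phi> ((s (j + 1) \<otimes> s j) [^] (3::nat)) = id"
    using cl assms by (simp add: numeral_3_eq_3 \<phi>_mult \<phi>_one \<phi>_s) (auto simp: fun_eq_iff transpose_def)
  then have "\<phi> (z m j) = id"
    unfolding z_def using cl by (simp add: \<phi>_mult \<phi>_inv)
  ultimately show ?thesis by (simp add: P_def)
qed

lemma z_carrier: "1 \<le> j \<Longrightarrow> j < m \<Longrightarrow> m < N \<Longrightarrow> z m j \<in> carrier G"
  using z_in_P[of j m] T_carrier[of "Suc m"] by (simp add: P_def)

text \<open>The rewriting rule behind the Schreier argument: a generator to the right of
  \<open>c m p\<close> moves to its left with index lowered by one, so that it lands in
  \<open>T m\<close>, at the cost of a pure factor.\<close>

lemma c_s_exchange: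
  assumes j: "p \<le> j" "j < m" "m < N" "1 \<le> p"
  shows "c m p \<otimes> s (j + 1) = z m j \<otimes> (s j \<otimes> c m p)"
proof -
  \<comment> \<open>The descending word is cut as \<open>c m p\<close> = e a b d, with b commuting
    with e and a commuting with d.\<close>
  define e a b d where ed: "e = c m (j + 2)" "a = s (j + 1)" "b = s j" "d = c (j - 1) p"
  have cl: "e \<in> carrier G" "a \<in> carrier G" "b \<in> carrier G" "d \<in> carrier G"
    using j unfolding ed by (auto intro: c_carrier s_closed)
  have "c (j + 1) p = a \<otimes> (b \<otimes> d)"
    using j unfolding ed by (cases j) auto
  then have cm: "c m p = e \<otimes> (a \<otimes> (b \<otimes> d))"
    using c_split[of p "j + 2" m] j unfolding ed by simp
  have ad: "d \<otimes> a = a \<otimes> d"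
    using s_c_comm[of "j + 1" p "j - 1"] j unfolding ed by simp
  have be: "b \<otimes> e = e \<otimes> b"
    using s_c_comm[of j "j + 2" m] j unfolding ed by simp
  have aa: "\<And>x. x \<in> carrier G \<Longrightarrow> a \<otimes> (a \<otimes> x) = x" and bb: "\<And>x. x \<in> carrier G \<Longrightarrow> b \<otimes> (b \<otimes> x) = x"
    using s_cancel j unfolding ed by auto
  have "b \<otimes> c m p = e \<otimes> (b \<otimes> (a \<otimes> (b \<otimes> d)))"
    using cl be by (metis cm m_assoc m_closed)
  then have "z m j \<otimes> (b \<otimes> c m p) =
      e \<otimes> ((a \<otimes> b) [^] (3::nat) \<otimes> (inv e \<otimes> (e \<otimes> (b \<otimes> (a \<otimes> (b \<otimes> d))))))"
    using cl unfolding z_def ed(1-3)[symmetric] by (simp add: m_assoc)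
  also have "\<dots> = e \<otimes> ((a \<otimes> b) [^] (3::nat) \<otimes> (b \<otimes> (a \<otimes> (b \<otimes> d))))"
    using cl by (simp add: m_assoc[symmetric])
  \<comment> \<open>The word (ababab)(bab) collapses to aba by cancelling squares.\<close>
  also have "\<dots> = e \<otimes> (a \<otimes> (b \<otimes> (a \<otimes> d)))"
    using cl aa bb by (simp add: numeral_3_eq_3 m_assoc)
  also have "\<dots> = c m p \<otimes> a"
    using cl ad by (simp add: cm m_assoc)
  finally show ?thesis unfolding ed by simp
qed

text \<open>Every letter of \<open>z m j\<close> has index between j and m, hence at distance at
  least 2 from i.\<close>

lemma z_s_comm:
  assumes "1 \<le> i" "i + 2 \<le> j" "j < m" "m < N"
  shows "s i \<otimes> z m j = z m j \<otimes> s i"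
proof (rule s_commutes)
  have jm: "1 \<le> j" using assms by simp
  have A: "s ` {j..m} \<subseteq> carrier G" using assms by (intro s_image_carrier) auto
  interpret S: subgroup "generate G (s ` {j..m})" G by (rule generate_is_subgroup[OF A])
  have "c m (j + 2) \<in> generate G (s ` {j..m})"
    using c_closed[of "j + 2" m] generate_s_mono[of "{j + 2..m}" "{j..m}"] assms by auto
  moreover have "s (j + 1) \<in> generate G (s ` {j..m})" "s j \<in> generate G (s ` {j..m})"
    using assms by (auto intro: generate.incl)
  ultimately show "z m j \<in> generate G (s ` {j..m})"
    unfolding z_def by (simp add: numeral_3_eq_3)
qed (use assms in auto)

text \<open>With a = \<open>s (j + 1)\<close> and b = \<open>s j\<close>, the element b commutes
  with the conjugator \<open>c m (j + 2)\<close>, and b (ab)^3 b = (ba)^3 is the inverse of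
  (ab)^3.\<close>

lemma z_s_inv:
  assumes "1 \<le> j" "j < m" "m < N"
  shows "s j \<otimes> z m j \<otimes> s j = inv (z m j)"
proof -
  define e a b where ed: "e = c m (j + 2)" "a = s (j + 1)" "b = s j"
  note cl = z_factors_carrier[OF assms, folded ed]
  have be: "b \<otimes> e = e \<otimes> b"
    using s_c_comm[of j "j + 2" m] assms unfolding ed by simp
  have be': "b \<otimes> inv e = inv e \<otimes> b"
    using be cl by (metis inv_closed inv_solve_left' inv_solve_right m_assoc m_closed)
  have ii: "inv a = a" "inv b = b" using s_inv assms unfolding ed by auto
  have bb: "b \<otimes> b = \<one>" using s_square assms unfolding ed by auto
  have "b \<otimes> z m j \<otimes> b = (b \<otimes> e) \<otimes> (a \<otimes> b) [^] (3::nat) \<otimes> (inv e \<otimes> b)"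
    using cl unfolding z_def ed[symmetric] by (simp add: m_assoc)
  also have "\<dots> = e \<otimes> (b \<otimes> (a \<otimes> b) [^] (3::nat) \<otimes> b) \<otimes> inv e"
    using cl by (simp add: be be'[symmetric] m_assoc)
  also have "b \<otimes> (a \<otimes> b) [^] (3::nat) \<otimes> b = inv ((a \<otimes> b) [^] (3::nat))"
    using cl by (simp add: numeral_3_eq_3 inv_mult_group ii m_assoc bb)
  also have "e \<otimes> inv ((a \<otimes> b) [^] (3::nat)) \<otimes> inv e = inv (z m j)"
    using cl unfolding z_def ed[symmetric] by (simp add: inv_mult_group m_assoc)
  finally show ?thesis unfolding ed .
qed

text \<open>Generated by the \<open>s i\<close> with i at most j - 2, which commute with
  \<open>z m j\<close>, and by \<open>s j\<close>, which inverts it. Conjugation by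
  \<open>L j\<close> thus preserves the pair formed by \<open>z m j\<close> and its inverse.\<close>

definition L :: "nat \<Rightarrow> 'a set" where "L j = generate G (s ` ({1..<j - 1} \<union> {j}))"

lemma L_conj:
  assumes j: "1 \<le> j" "j < m" "m < N" and "l \<in> L j"
  shows "inv l \<otimes> z m j \<otimes> l \<in> {z m j, inv (z m j)}"
proof -
  have A: "s ` ({1..<j - 1} \<union> {j}) \<subseteq> carrier G" using j by (intro s_image_carrier) auto
  have zc: "z m j \<in> carrier G" using z_carrier j by simp
  let ?U = "{l \<in> carrier G. inv l \<otimes> z m j \<otimes> l \<in> {z m j, inv (z m j)}}"
  have "\<one> \<otimes> l \<in> ?U"
  proof (rule closed_under_generate[OF A])
    show "l \<in> generate G (s ` ({1..<j - 1} \<union> {j}))" using assms by (simp add: L_def)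
    show "\<one> \<in> ?U" using zc by simp
  next
    fix u a assume u: "u \<in> ?U" and a: "a \<in> s ` ({1..<j - 1} \<union> {j})"
    have ac: "a \<in> carrier G" "inv a = a" using a A s_inv j by auto
    have "a \<otimes> z m j \<otimes> a \<in> {z m j, inv (z m j)}"
    proof (cases "a = s j")
      case True
      then show ?thesis using z_s_inv j by simp
    next
      case False
      then obtain i where "a = s i" "1 \<le> i" "i + 2 \<le> j" using a by auto
      then have "a \<otimes> z m j = z m j \<otimes> a" "a \<otimes> a = \<one>" using z_s_comm s_square j by auto
      then show ?thesis using ac zc by (simp add: m_assoc)
    qed
    \<comment> \<open>Since a is an involution, this is the inverse of the preceding
      conjugate.\<close>
    moreover from this have "a \<otimes> inv (z m j) \<otimes> a \<in> {z m j, inv (z m j)}"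
      using ac zc by (smt (verit) inv_closed inv_inv inv_mult_group insert_iff m_assoc m_closed singletonD)
    moreover have "inv (u \<otimes> a) \<otimes> z m j \<otimes> (u \<otimes> a) = a \<otimes> (inv u \<otimes> z m j \<otimes> u) \<otimes> a"
      using u ac zc by (simp add: inv_mult_group m_assoc)
    ultimately have "u \<otimes> a \<in> ?U" using u ac by auto
    then show "u \<otimes> a \<in> ?U \<and> u \<otimes> inv a \<in> ?U" using ac by simp
  qed auto
  moreover have "l \<in> carrier G"
    using assms(4) generate_in_carrier[OF A] by (simp add: L_def)
  ultimately show ?thesis by auto
qed

section \<open>Images in the symmetric group and the number of conjugates\<close>

text \<open>Adjacent transpositions generate the symmetric group. The inner downward induction moves
  the preimage p of \<open>Suc m\<close> up to \<open>Suc m\<close>; the permutation then fixes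
  \<open>Suc m\<close> and the outer induction applies.\<close>

lemma \<phi>_generates:
  assumes "m \<le> N" "f permutes {1..m}"
  shows "\<exists>t\<in>T m. \<phi> t = f"
  using assms
proof (induction m arbitrary: f)
  case 0
  then show ?case using generate.one[of G "{}"] \<phi>_one by (intro bexI[of _ \<one>]) (auto simp: T_def id_def)
next
  case (Suc m)
  interpret TS: subgroup "T (Suc m)" G using T_subgroup Suc by simp
  have "\<exists>t\<in>T (Suc m). \<phi> t = g"
    if "g p = Suc m" "1 \<le> p" "p \<le> Suc m" "g permutes {1..Suc m}" for p g
    using that(3,2,1,4)
  proof (induction p arbitrary: g rule: inc_induct)
    case base
    have "g permutes {1..m}"
    proof (rule permutes_superset)
      show "g permutes {1..Suc m}" by (rule base)
      show "g x = x" if "x \<in> {1..Suc m} - {1..m}" for x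
        using that base by (cases "x = Suc m") auto
    qed
    then show ?case using Suc.IH[of g] Suc.prems T_mono[of m "Suc m"] by auto
  next
    case (step p)
    let ?t = "transpose p (p + 1)"
    have "(g \<circ> ?t) permutes {1..Suc m}"
      using step by (intro permutes_compose permutes_swap_id) auto
    moreover have "(g \<circ> ?t) (Suc p) = Suc m" using step by simp
    moreover have "1 \<le> Suc p" by simp
    ultimately have "\<exists>t\<in>T (Suc m). \<phi> t = g \<circ> ?t" by (intro step.IH)
    then obtain t where t: "t \<in> T (Suc m)" "\<phi> t = g \<circ> ?t" by blast
    have "s p \<in> T (Suc m)" using step by (intro s_in_T) auto
    moreover have "\<phi> (t \<otimes> s p) = g"
      using t step Suc.prems TS.mem_carrier by (simp add: \<phi>_mult s_closed \<phi>_s comp_assoc)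
    ultimately show ?case using t by blast
  qed
  moreover have "Suc m \<in> f ` {1..Suc m}"
    using permutes_image[OF Suc.prems(2)] by simp
  ultimately show ?case using Suc.prems by auto
qed

lemma \<phi>_permutes:
  assumes "m \<le> N" "t \<in> T m"
  shows "\<phi> t permutes {1..m}"
proof -
  let ?U = "{x \<in> carrier G. \<phi> x permutes {1..m}}"
  have A: "s ` {1..<m} \<subseteq> carrier G" using assms by (intro s_image_carrier) auto
  have "\<one> \<otimes> t \<in> ?U"
  proof (rule closed_under_generate[OF A])
    show "t \<in> generate G (s ` {1..<m})" using assms by (simp add: T_def)
    fix u a assume u: "u \<in> ?U" and "a \<in> s ` {1..<m}"
    then obtain i where i: "a = s i" "i \<in> {1..<m}" by blast
    then have "u \<otimes> a \<in> ?U"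
      using u assms by (auto simp: s_closed \<phi>_mult \<phi>_s intro!: permutes_compose permutes_swap_id)
    then show "u \<otimes> a \<in> ?U \<and> u \<otimes> inv a \<in> ?U" using i assms by (simp add: s_inv)
  qed (auto simp: \<phi>_one permutes_id)
  then show ?thesis using T_carrier[OF assms] by simp
qed

lemma L_subgroup: "j < N \<Longrightarrow> 1 \<le> j \<Longrightarrow> subgroup (L j) G"
  unfolding L_def by (rule generate_is_subgroup, rule s_image_carrier) auto

lemma L_subset_T: "1 \<le> j \<Longrightarrow> j < m \<Longrightarrow> L j \<subseteq> T m"
  unfolding L_def T_def by (intro generate_s_mono) auto

text \<open>Placed inside \<open>sym_group m\<close>, of order m!, so that Lagrange's theorem can
  count the cosets.\<close>

lemma \<phi>_L_subgroup:
  assumes "1 \<le> j" "j < m" "m < N"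
  shows "subgroup (\<phi> ` L j) (sym_group m)"
proof -
  interpret LS: subgroup "L j" G using L_subgroup assms by simp
  interpret S: group "sym_group m" by (rule sym_group_is_group)
  have perm: "\<phi> ` L j \<subseteq> carrier (sym_group m)"
    using \<phi>_permutes[of m] L_subset_T[of j m] assms by (auto simp: sym_group_carrier)
  show ?thesis
  proof (rule S.subgroupI[OF perm])
    show "\<phi> ` L j \<noteq> {}" using LS.one_closed by blast
    fix a assume "a \<in> \<phi> ` L j"
    then obtain x where x: "a = \<phi> x" "x \<in> L j" by blast
    have "inv\<^bsub>sym_group m\<^esub> a = \<phi> (inv x)"
      using x perm \<phi>_inv[of x] LS.mem_carrier
      by (intro S.inv_equality) (auto simp: sym_group_mult sym_group_one)
    then show "inv\<^bsub>sym_group m\<^esub> a \<in> \<phi> ` L j" using x by simp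
    fix b assume "b \<in> \<phi> ` L j"
    then obtain y where y: "b = \<phi> y" "y \<in> L j" by blast
    then have "a \<otimes>\<^bsub>sym_group m\<^esub> b = \<phi> (x \<otimes> y)"
      using x LS.mem_carrier by (simp add: sym_group_mult \<phi>_mult)
    then show "a \<otimes>\<^bsub>sym_group m\<^esub> b \<in> \<phi> ` L j" using x y by simp
  qed
qed

text \<open>The image contains all permutations of the first j - 1 points, each with or without the
  disjoint transposition of j and j + 1.\<close>

lemma card_\<phi>_L:
  assumes "1 \<le> j" "j < m" "m < N"
  shows "2 * fact (j - 1) \<le> card (\<phi> ` L j)"
proof -
  let ?A = "{f. f permutes {1..j - 1}} \<times> (UNIV :: bool set)"
  let ?tau = "transpose j (j + 1)"
  define h where "h = (\<lambda>(f :: nat \<Rightarrow> nat, b :: bool). f \<circ> (if b then ?tau else id))"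
  interpret LS: subgroup "L j" G using L_subgroup assms by simp
  have fin: "finite (\<phi> ` L j)"
    by (rule finite_subset[OF subgroup.subset[OF \<phi>_L_subgroup[OF assms]]])
      (simp add: sym_group_def finite_permutations)
  have "h ` ?A \<subseteq> \<phi> ` L j"
  proof clarify
    fix f b assume "f permutes {1..j - 1}"
    moreover have "j - 1 \<le> N" using assms by linarith
    ultimately obtain t where t: "t \<in> T (j - 1)" "\<phi> t = f"
      using \<phi>_generates by blast
    have tL: "t \<in> L j"
      using t generate_s_mono[of "{1..<j - 1}" "{1..<j - 1} \<union> {j}"] by (auto simp: T_def L_def)
    have sL: "s j \<in> L j" by (auto simp: L_def intro: generate.incl)
    have "h (f, b) = \<phi> (if b then t \<otimes> s j else t)"
      using t tL sL LS.mem_carrier assms by (simp add: h_def \<phi>_mult \<phi>_s)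
    then show "h (f, b) \<in> \<phi> ` L j" using tL sL by auto
  qed
  moreover have "inj_on h ?A"
  proof (rule inj_onI, clarify)
    fix f b f' b'
    assume f: "f permutes {1..j - 1}" "f' permutes {1..j - 1}" and eq: "h (f, b) = h (f', b')"
    have fixed: "f j = j" "f (j + 1) = j + 1" "f' j = j" "f' (j + 1) = j + 1"
      using permutes_not_in[OF f(1)] permutes_not_in[OF f(2)] assms by auto
    \<comment> \<open>The value at j reveals whether the transposition is present, as f and f' fix
      both j and j + 1.\<close>
    have b: "b = b'"
      using fun_cong[OF eq, of j] fixed by (auto simp: h_def split: if_splits)
    have "f \<circ> (?tau \<circ> ?tau) = f' \<circ> (?tau \<circ> ?tau)" if "f \<circ> ?tau = f' \<circ> ?tau"
      using that by (simp only: comp_assoc[symmetric])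
    then have "f \<circ> ?tau = f' \<circ> ?tau \<Longrightarrow> f = f'" by simp
    then have "f = f'" using eq b by (cases b) (simp_all add: h_def)
    then show "f = f' \<and> b = b'" using b by simp
  qed
  ultimately have "card ?A \<le> card (\<phi> ` L j)"
    using card_inj_on_le fin by blast
  then show ?thesis by (simp add: card_cartesian_product card_permutations[OF HOL.refl])
qed

lemma z_conjugates_generated:
  assumes "1 \<le> j" "j < m" "m < N"
  obtains Z where "finite Z" "Z \<subseteq> P (Suc m)" "card Z * (2 * fact (j - 1)) \<le> fact m"
    "\<And>H t. subgroup H G \<Longrightarrow> P m \<subseteq> H \<Longrightarrow> Z \<subseteq> H \<Longrightarrow> t \<in> T m \<Longrightarrow> inv t \<otimes> z m j \<otimes> t \<in> H"
proof -
  interpret S: group "sym_group m" by (rule sym_group_is_group)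
  interpret TS: subgroup "T m" G using T_subgroup assms by simp
  interpret TS': subgroup "T (Suc m)" G using T_subgroup assms by simp
  interpret LS: subgroup "L j" G using L_subgroup assms by simp
  note K = \<phi>_L_subgroup[OF assms]
  note LT = L_subset_T[OF assms(1,2)]
  have zc: "z m j \<in> carrier G" using z_carrier assms by simp
  define R where "R = rcosets\<^bsub>sym_group m\<^esub> (\<phi> ` L j)"
  define rep where "rep C = (SOME t. t \<in> T m \<and> \<phi> t \<in> C)" for C
  define Z where "Z = (\<lambda>C. inv (rep C) \<otimes> z m j \<otimes> rep C) ` R"
  have finS: "finite (carrier (sym_group m))" "order (sym_group m) = fact m"
    using finite_permutations[of "{1..m}"]
    by (auto simp: sym_group_def order_def card_permutations[OF HOL.refl])
  have finR: "finite R"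
    unfolding R_def RCOSETS_def using finS by auto
  have rep: "rep C \<in> T m \<and> \<phi> (rep C) \<in> C" if C: "C \<in> R" for C
  proof -
    obtain f where f: "f \<in> carrier (sym_group m)" "C = \<phi> ` L j #>\<^bsub>sym_group m\<^esub> f"
      using C unfolding R_def RCOSETS_def by blast
    then have "f \<in> C" using S.rcos_self[OF _ K] by simp
    moreover obtain t where "t \<in> T m" "\<phi> t = f"
      using f \<phi>_generates[of m f] assms by (auto simp: sym_group_carrier)
    ultimately have "\<exists>t. t \<in> T m \<and> \<phi> t \<in> C" by blast
    then show ?thesis unfolding rep_def by (rule someI_ex)
  qed
  show thesis
  proof (rule that)
    show "finite Z" unfolding Z_def using finR by simp
    show "Z \<subseteq> P (Suc m)"
    proof
      fix x assume "x \<in> Z"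
      then obtain C where C: "C \<in> R" "x = inv (rep C) \<otimes> z m j \<otimes> rep C" unfolding Z_def by blast
      have r: "rep C \<in> T (Suc m)" "rep C \<in> carrier G" using rep[OF C(1)] T_mono[of m "Suc m"] by auto
      have "z m j \<in> T (Suc m)" "\<phi> (z m j) = id" using z_in_P[OF assms] by (auto simp: P_def)
      then show "x \<in> P (Suc m)" using C(2) r zc by (simp add: P_def \<phi>_mult \<phi>_inv)
    qed
    have "card Z * (2 * fact (j - 1)) \<le> card R * card (\<phi> ` L j)"
      unfolding Z_def by (intro mult_le_mono card_image_le finR card_\<phi>_L[OF assms])
    also have "\<dots> = fact m" using S.lagrange[OF K] finS by (simp add: R_def)
    finally show "card Z * (2 * fact (j - 1)) \<le> fact m" .
    fix H t assume H: "subgroup H G" "P m \<subseteq> H" "Z \<subseteq> H" and t: "t \<in> T m"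
    interpret HS: subgroup H G by (rule H(1))
    define C where "C = \<phi> ` L j #>\<^bsub>sym_group m\<^esub> \<phi> t"
    define r where "r = rep C"
    have "\<phi> t \<in> carrier (sym_group m)"
      using \<phi>_permutes[of m t] t assms by (simp add: sym_group_carrier)
    then have C: "C \<in> R" unfolding C_def R_def using S.rcosetsI[OF subgroup.subset[OF K]] by simp
    have r: "r \<in> T m" using rep[OF C] by (simp add: r_def)
    obtain l where l: "l \<in> L j" "\<phi> r = \<phi> l \<circ> \<phi> t"
      using rep[OF C] unfolding r_def C_def by (auto simp: r_coset_def sym_group_mult)
    \<comment> \<open>Both r and l t have the same permutation, so q is pure. In t = l^-1 r q,
      conjugation by l^-1 at most inverts \<open>z m j\<close>, then r gives an element of
      \<open>Z\<close> or its inverse, and q lies in \<open>H\<close>.\<close>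
    define q where "q = inv r \<otimes> (l \<otimes> t)"
    have cl: "l \<in> carrier G" "r \<in> carrier G" "t \<in> carrier G" using l r t by auto
    then have qc: "q \<in> carrier G" by (simp add: q_def)
    have "\<phi> q = id" using cl l(2) by (simp add: q_def \<phi>_mult \<phi>_inv flip: l(2))
    moreover have "q \<in> T m" unfolding q_def using l(1) LT r t by auto
    ultimately have q: "q \<in> H" using H by (auto simp: P_def)
    have "r \<otimes> q = l \<otimes> t" using cl by (simp add: q_def flip: m_assoc)
    then have t_eq: "t = inv l \<otimes> (r \<otimes> q)" using cl by (simp flip: m_assoc)
    have "inv t \<otimes> z m j \<otimes> t = inv q \<otimes> (inv r \<otimes> (inv (inv l) \<otimes> z m j \<otimes> inv l) \<otimes> r) \<otimes> q"
      using cl qc zc unfolding t_eq by (simp add: inv_mult_group m_assoc)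
    moreover have "inv (inv l) \<otimes> z m j \<otimes> inv l \<in> {z m j, inv (z m j)}"
      using L_conj[OF assms, of "inv l"] l by simp
    moreover have *: "inv r \<otimes> z m j \<otimes> r \<in> H" using H(3) C by (auto simp: Z_def r_def)
    moreover have "inv r \<otimes> inv (z m j) \<otimes> r = inv (inv r \<otimes> z m j \<otimes> r)"
      using cl zc by (simp add: inv_mult_group m_assoc)
    ultimately show "inv t \<otimes> z m j \<otimes> t \<in> H" using q by auto
  qed
qed

section \<open>Schreier argument for adding one strand\<close>

lemma P_generation_step:
  assumes m: "1 \<le> m" "m < N" and S: "finite S" "S \<subseteq> P m" "generate G S = P m"
  obtains S' where "finite S'" "S' \<subseteq> P (Suc m)" "generate G S' = P (Suc m)"
    "real (card S') \<le> real (card S) + (\<Sum>j = 1..<m. fact m / (2 * fact (j - 1)))"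
proof -
  interpret TS: subgroup "T m" G using T_subgroup m by simp
  interpret TS': subgroup "T (Suc m)" G using T_subgroup m by simp
  interpret PS: subgroup "P (Suc m)" G using P_subgroup m by simp
  \<comment> \<open>Bundling the properties into one predicate allows a simultaneous choice of the
    sets for all j.\<close>
  define good where "good j Y \<longleftrightarrow> finite Y \<and> Y \<subseteq> P (Suc m) \<and> card Y * (2 * fact (j - 1)) \<le> fact m \<and>
      (\<forall>H t. subgroup H G \<longrightarrow> P m \<subseteq> H \<longrightarrow> Y \<subseteq> H \<longrightarrow> t \<in> T m \<longrightarrow> inv t \<otimes> z m j \<otimes> t \<in> H)" for j Y
  have "\<exists>Z. \<forall>j\<in>{1..<m}. good j (Z j)"
  proof (rule bchoice, rule ballI)
    fix j assume "j \<in> {1..<m}"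
    then have j: "1 \<le> j" "j < m" by auto
    from z_conjugates_generated[OF j m(2)] obtain Y where "finite Y" "Y \<subseteq> P (Suc m)"
      "card Y * (2 * fact (j - 1)) \<le> fact m"
      "\<And>H t. subgroup H G \<Longrightarrow> P m \<subseteq> H \<Longrightarrow> Y \<subseteq> H \<Longrightarrow> t \<in> T m \<Longrightarrow> inv t \<otimes> z m j \<otimes> t \<in> H"
      by metis
    then show "\<exists>Y. good j Y" unfolding good_def by (intro exI[of _ Y] conjI allI impI)
  qed
  then obtain Z where "\<forall>j\<in>{1..<m}. good j (Z j)" by blast
  note good = bspec[OF this]
  note Z = good[unfolded good_def, THEN conjunct1] good[unfolded good_def, THEN conjunct2, THEN conjunct1]
    good[unfolded good_def, THEN conjunct2, THEN conjunct2, THEN conjunct1]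
    good[unfolded good_def, THEN conjunct2, THEN conjunct2, THEN conjunct2, rule_format]
  define S' where "S' = S \<union> (\<Union>j\<in>{1..<m}. Z j)"
  define H where "H = generate G S'"
  have PP: "P m \<subseteq> P (Suc m)" using T_mono[of m "Suc m"] by (auto simp: P_def)
  have S'P: "S' \<subseteq> P (Suc m)" using S(2) PP Z(2) unfolding S'_def by blast
  have S'c: "S' \<subseteq> carrier G" using S'P PS.subset by blast
  have HG: "subgroup H G" unfolding H_def by (rule generate_is_subgroup[OF S'c])
  interpret HS: subgroup H G by (rule HG)
  have S'H: "S' \<subseteq> H" unfolding H_def by (auto intro: generate.incl)
  have PH: "P m \<subseteq> H" unfolding H_def S(3)[symmetric] by (rule mono_generate) (auto simp: S'_def)
  have HP: "H \<subseteq> P (Suc m)" unfolding H_def by (rule generate_subgroup_incl[OF S'P PS.subgroup_axioms])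
  have zH: "t \<otimes> z m j \<otimes> inv t \<in> H" if "t \<in> T m" "1 \<le> j" "j < m" for t j
  proof -
    have j: "j \<in> {1..<m}" using that by simp
    then have "Z j \<subseteq> H" using S'H unfolding S'_def by blast
    then show ?thesis using Z(4)[OF j HG PH, of "inv t"] that by simp
  qed
  \<comment> \<open>The aim is that \<open>U\<close> contains all of \<open>T (Suc m)\<close>. The
    value p = \<open>Suc m\<close> supplies the trivial representative.\<close>
  define U where "U = {h \<otimes> (t \<otimes> c m p) | h t p. h \<in> H \<and> t \<in> T m \<and> 1 \<le> p \<and> p \<le> Suc m}"
  have UI: "h \<otimes> (t \<otimes> c m p) \<in> U" if "h \<in> H" "t \<in> T m" "1 \<le> p" "p \<le> Suc m" for h t p
    using that unfolding U_def by blast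
  have A: "s ` {1..<Suc m} \<subseteq> carrier G" using m by (intro s_image_carrier) auto
  have "\<one> \<otimes> x \<in> U" if "x \<in> T (Suc m)" for x
  proof (rule closed_under_generate[OF A])
    show "x \<in> generate G (s ` {1..<Suc m})" using that by (simp add: T_def)
    show "U \<subseteq> carrier G" unfolding U_def using m by (auto intro!: m_closed c_carrier)
    show "\<one> \<in> U" using UI[of \<one> \<one> "Suc m"] by (simp add: c_beyond)
    fix u a assume u: "u \<in> U" and "a \<in> s ` {1..<Suc m}"
    then obtain i where i: "a = s i" "1 \<le> i" "i \<le> m" by auto
    obtain h t p where htp: "u = h \<otimes> (t \<otimes> c m p)" "h \<in> H" "t \<in> T m" "1 \<le> p" "p \<le> Suc m"
      using u unfolding U_def by blast
    have cl: "h \<in> carrier G" "t \<in> carrier G" "c m p \<in> carrier G" "s i \<in> carrier G"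
      using htp i m by (auto intro: c_carrier s_closed)
    have ua: "u \<otimes> a = h \<otimes> (t \<otimes> (c m p \<otimes> s i))" using cl by (simp add: htp i m_assoc)
    \<comment> \<open>Respectively, \<open>s i\<close> commutes past \<open>c m p\<close> into
      \<open>T m\<close>, extends it by a letter, cancels its last letter, or is moved across by the
      exchange rule.\<close>
    consider "i + 2 \<le> p" | "p = Suc i" | "p = i" | "p < i" by linarith
    then have "u \<otimes> a \<in> U"
    proof cases
      case 1
      then have "s i \<in> T m" using i htp by (auto intro: s_in_T)
      moreover have "u \<otimes> a = h \<otimes> ((t \<otimes> s i) \<otimes> c m p)"
        using ua s_c_comm[of i p m] 1 cl i htp m by (simp add: m_assoc)
      ultimately show ?thesis using UI htp by simp
    next
      case 2
      then have "u \<otimes> a = h \<otimes> (t \<otimes> c m i)" using ua c_Suc[of i m] i m by simp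
      then show ?thesis using UI htp i by simp
    next
      case 3
      have "c m (Suc i) \<in> carrier G" using m by (intro c_carrier) auto
      then have "c m p \<otimes> s i = c m (Suc i)"
        using c_Suc[of i m] 3 i m cl s_square[of i] by (simp add: m_assoc)
      then show ?thesis using ua UI[of h t "Suc i"] htp i by simp
    next
      case 4
      then obtain j where j: "i = j + 1" "p \<le> j" "1 \<le> j" "j < m" using i htp by (cases i) auto
      have zj: "z m j \<in> carrier G" "s j \<in> carrier G" "s j \<in> T m"
        using z_carrier s_closed s_in_T j m by auto
      have "u \<otimes> a = h \<otimes> (t \<otimes> (z m j \<otimes> (s j \<otimes> c m p)))"
        using ua c_s_exchange[of p j m] j htp m by simp
      \<comment> \<open>Inserting t^-1 t after \<open>z m j\<close> groups the word into an
        \<open>H\<close> part, a \<open>T m\<close> part and the same representative.\<close>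
      also have "\<dots> = (h \<otimes> (t \<otimes> z m j \<otimes> inv t)) \<otimes> ((t \<otimes> s j) \<otimes> c m p)"
        using cl zj by (simp add: m_assoc) (simp flip: m_assoc)
      also have "\<dots> \<in> U"
        using htp zj zH[of t j] j by (intro UI) auto
      finally show ?thesis .
    qed
    moreover have "inv a = a" using i m s_inv by simp
    ultimately show "u \<otimes> a \<in> U \<and> u \<otimes> inv a \<in> U" by simp
  qed
  then have TU: "x \<in> U" if "x \<in> T (Suc m)" for x using that by fastforce
  have "P (Suc m) \<subseteq> H"
  proof
    fix x assume x: "x \<in> P (Suc m)"
    then obtain h t p where htp: "x = h \<otimes> (t \<otimes> c m p)" "h \<in> H" "t \<in> T m" "1 \<le> p" "p \<le> Suc m"
      using TU[of x] unfolding P_def U_def by blast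
    have cl: "h \<in> carrier G" "t \<in> carrier G" "c m p \<in> carrier G"
      using htp m by (auto intro: c_carrier)
    have "\<phi> h = id" "\<phi> x = id" using htp HP x by (auto simp: P_def)
    then have tc: "\<phi> t \<circ> \<phi> (c m p) = id" using cl by (simp add: htp(1) \<phi>_mult)
    \<comment> \<open>Following the point p: \<open>c m p\<close> sends it to \<open>Suc m\<close>,
      which t fixes. Purity then forces p = \<open>Suc m\<close>, leaving only h and a pure
      t.\<close>
    have "p = \<phi> t (\<phi> (c m p) p)" using fun_cong[OF tc, of p] by simp
    also have "\<dots> = Suc m"
      using \<phi>_c[of p m] htp m permutes_not_in[OF \<phi>_permutes[of m t], of "Suc m"] by simp
    finally have c1: "c m p = \<one>" by (simp add: c_beyond)
    then have "t \<in> P m" using tc htp by (simp add: P_def \<phi>_one)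
    then show "x \<in> H" using c1 htp cl PH by auto
  qed
  then have gen: "generate G S' = P (Suc m)" using HP by (simp add: H_def)
  have "card S' \<le> card S + card (\<Union>j\<in>{1..<m}. Z j)" unfolding S'_def by (rule card_Un_le)
  also have "card (\<Union>j\<in>{1..<m}. Z j) \<le> (\<Sum>j = 1..<m. card (Z j))" by (rule card_UN_le) simp
  finally have "real (card S') \<le> real (card S) + (\<Sum>j = 1..<m. real (card (Z j)))"
    by (metis add_left_mono of_nat_add of_nat_mono of_nat_sum)
  also have "(\<Sum>j = 1..<m. real (card (Z j))) \<le> (\<Sum>j = 1..<m. fact m / (2 * fact (j - 1)))"
  proof (rule sum_mono)
    fix j assume "j \<in> {1..<m}"
    from Z(3)[OF this] have "real (card (Z j) * (2 * fact (j - 1))) \<le> real (fact m)"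
      by (rule of_nat_mono)
    then show "real (card (Z j)) \<le> fact m / (2 * fact (j - 1))"
      by (simp add: field_simps)
  qed
  finally have "real (card S') \<le> real (card S) + (\<Sum>j = 1..<m. fact m / (2 * fact (j - 1)))" by simp
  moreover have "finite S'" using S Z(1) by (auto simp: S'_def)
  ultimately show thesis using that[OF _ S'P gen] by blast
qed

lemma P_generated:
  assumes "1 \<le> m" "m \<le> N"
  shows "\<exists>S. finite S \<and> S \<subseteq> P m \<and> generate G S = P m \<and>
    real (card S) \<le> (\<Sum>k = 1..<m. \<Sum>j = 1..<k. fact k / (2 * fact (j - 1)))"
  using assms
proof (induction m rule: dec_induct)
  case base
  have "P 1 = {\<one>}" by (auto simp: P_def T_def \<phi>_one generate_empty)
  then show ?case by (intro exI[of _ "{}"]) (simp add: generate_empty)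
next
  case (step m)
  then obtain S where S: "finite S" "S \<subseteq> P m" "generate G S = P m"
    "real (card S) \<le> (\<Sum>k = 1..<m. \<Sum>j = 1..<k. fact k / (2 * fact (j - 1)))"
    by auto
  obtain S' where "finite S'" "S' \<subseteq> P (Suc m)" "generate G S' = P (Suc m)"
    "real (card S') \<le> real (card S) + (\<Sum>j = 1..<m. fact m / (2 * fact (j - 1)))"
    using P_generation_step[of m S] S step by auto
  then show ?case using S(4) step(1) by (intro exI[of _ S']) auto
qed

end

section \<open>Transfer to the presented twin group\<close>

lemma twin_gen_word_eq:
  assumes "i \<in> {1..<n}" "j \<in> {1..<n}"
  shows "twin_gen n i \<otimes>\<^bsub>twin_group n\<^esub> twin_gen n j =
    pres_cong {1..<n} (twin_rels n) `` {[(i, True), (j, True)]}"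
  unfolding twin_gen_def pres_gen_def twin_group_def
  by (subst presented_group_mult[OF twin_rels_in_lists]) (use assms in auto)

lemma twin_rel_class:
  assumes "(v, w) \<in> twin_rels n"
  shows "pres_cong {1..<n} (twin_rels n) `` {v} = pres_cong {1..<n} (twin_rels n) `` {w}"
proof (rule equiv_class_eq[OF pres_cong_equiv[OF twin_rels_in_lists]])
  show "(v, w) \<in> pres_cong {1..<n} (twin_rels n)"
    using pres_cong.rel[of "[]" "{1..<n}" "[]" v w "twin_rels n"] assms by simp
qed

lemma twin_group_quotient: "twin_quotient (twin_group n) n (twin_perm n) (twin_gen n)"
proof -
  interpret group "twin_group n" by (rule twin_group_is_group)
  show ?thesis
  proof
    show "twin_perm n \<in> hom (twin_group n) (sym_group n)" by (rule twin_perm_hom)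
    fix i assume i: "i \<in> {1..<n}"
    show "twin_gen n i \<in> carrier (twin_group n)"
      unfolding twin_gen_def pres_gen_def twin_group_def
      by (rule presented_group_classI) (use i in auto)
    have "([(i, True), (i, True)], []) \<in> twin_rels n" using i by (auto simp: twin_rels_def)
    from twin_rel_class[OF this]
    show "twin_gen n i \<otimes>\<^bsub>twin_group n\<^esub> twin_gen n i = \<one>\<^bsub>twin_group n\<^esub>"
      using i by (simp add: twin_gen_word_eq) (simp add: twin_group_def presented_group_def)
    show "twin_perm n (twin_gen n i) = transpose i (i + 1)" by (rule twin_perm_gen[OF i])
    fix j assume j: "j \<in> {1..<n}" "i + 2 \<le> j"
    have "([(i, True), (j, True)], [(j, True), (i, True)]) \<in> twin_rels n"
      using i j by (auto simp: twin_rels_def)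
    from twin_rel_class[OF this]
    show "twin_gen n i \<otimes>\<^bsub>twin_group n\<^esub> twin_gen n j = twin_gen n j \<otimes>\<^bsub>twin_group n\<^esub> twin_gen n i"
      using i j by (simp add: twin_gen_word_eq)
  qed
qed

text \<open>Induction on words, the class of a formal inverse letter being the group inverse by
  cancellation. It identifies \<open>T n\<close> with the whole twin group.\<close>

lemma presented_group_generated:
  assumes R: "R \<subseteq> lists (X \<times> UNIV) \<times> lists (X \<times> UNIV)"
  shows "generate (presented_group X R) (pres_gen X R ` X) = carrier (presented_group X R)"
proof -
  let ?G = "presented_group X R" and ?cl = "\<lambda>w. pres_cong X R `` {w}"
  interpret group ?G by (rule presented_group_is_group[OF R])
  have gen_closed: "pres_gen X R ` X \<subseteq> carrier ?G"
    by (auto simp: pres_gen_def intro!: presented_group_classI)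
  have letter: "?cl [(x, b)] \<in> generate ?G (pres_gen X R ` X)" if x: "x \<in> X" for x b
  proof (cases b)
    case True
    then show ?thesis using x by (auto simp: pres_gen_def intro: generate.incl)
  next
    case False
    have "?cl [(x, False)] \<otimes>\<^bsub>?G\<^esub> pres_gen X R x = ?cl [(x, False), (x, True)]"
      unfolding pres_gen_def by (subst presented_group_mult[OF R]) (use x in auto)
    also have "\<dots> = ?cl []"
      using pres_cong.cancel[of "[]" X "[]" x False R] x
      by (intro equiv_class_eq[OF pres_cong_equiv[OF R]]) simp
    also have "\<dots> = \<one>\<^bsub>?G\<^esub>" by (simp add: presented_group_def)
    finally have inv_gen: "inv\<^bsub>?G\<^esub> (pres_gen X R x) = ?cl [(x, False)]"
      using x gen_closed by (intro inv_equality) (auto intro!: presented_group_classI)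
    have "inv\<^bsub>?G\<^esub> (pres_gen X R x) \<in> generate ?G (pres_gen X R ` X)"
      using x by (intro generate.inv imageI)
    then show ?thesis using False by (simp add: inv_gen)
  qed
  have "?cl w \<in> generate ?G (pres_gen X R ` X)" if "w \<in> lists (X \<times> UNIV)" for w
    using that
  proof (induction w)
    case Nil
    then show ?case using generate.one[of ?G] by (simp add: presented_group_def)
  next
    case (Cons a w)
    obtain x b where a: "a = (x, b)" "x \<in> X" using Cons(1) by (cases a) simp
    have "?cl (a # w) = ?cl [a] \<otimes>\<^bsub>?G\<^esub> ?cl w"
      using presented_group_mult[OF R, of "[a]" w] Cons by simp
    then show ?case using generate.eng[OF letter[OF a(2), of b] Cons(3)] a(1) by simp
  qed
  then have "carrier ?G \<subseteq> generate ?G (pres_gen X R ` X)"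
    by (metis presented_group_carrierE subsetI)
  then show ?thesis
    using generate_incl[OF gen_closed] by blast
qed

lemma group_rank_le_card:
  "finite S \<Longrightarrow> S \<subseteq> carrier G \<Longrightarrow> generate G S = carrier G \<Longrightarrow> group_rank G \<le> enat (card S)"
  unfolding group_rank_def by (rule INF_lower) simp

lemma pure_twin_group_generated:
  assumes "1 \<le> n"
  shows "\<exists>S. finite S \<and> S \<subseteq> carrier (pure_twin_group n) \<and>
    generate (pure_twin_group n) S = carrier (pure_twin_group n) \<and>
    real (card S) \<le> (\<Sum>k = 1..<n. \<Sum>j = 1..<k. fact k / (2 * fact (j - 1)))"
proof -
  interpret twin_quotient "twin_group n" n "twin_perm n" "twin_gen n"
    by (rule twin_group_quotient)
  have "T n = carrier (twin_group n)"
    unfolding T_def unfolding twin_gen_def twin_group_def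
    by (rule presented_group_generated[OF twin_rels_in_lists])
  then have P_eq: "P n = carrier (pure_twin_group n)"
    by (auto simp: P_def pure_twin_group_def kernel_def sym_group_one)
  have G_eq: "pure_twin_group n = (twin_group n)\<lparr>carrier := P n\<rparr>"
    unfolding P_eq by (simp add: pure_twin_group_def)
  obtain S where S: "finite S" "S \<subseteq> P n" "generate (twin_group n) S = P n"
    "real (card S) \<le> (\<Sum>k = 1..<n. \<Sum>j = 1..<k. fact k / (2 * fact (j - 1)))"
    using P_generated[OF assms order_refl] by blast
  \<comment> \<open>Inverses are formed in different structures on the two sides; they agree because
    \<open>P n\<close> is a subgroup.\<close>
  have "generate (pure_twin_group n) S = generate (twin_group n) S"
    unfolding G_eq by (rule generate_consistent[OF S(2) P_subgroup]) simp
  then have "generate (pure_twin_group n) S = P n" using S(3) by (rule HOL.trans)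
  then show ?thesis
    using S(1,2,4) unfolding P_eq by blast
qed

section \<open>Comparison with the recurrence and the rank bound\<close>

text \<open>The last term telescopes: N^2/(N+1)! + N/(N+1)! = N/N!, so passing to N + 1 adds 1/N! on
  the right but only 1/(2 N!) on the left. Both sides equal 1 at N = 2.\<close>

lemma sum_inverse_fact_le:
  assumes "N \<ge> 2"
  shows "(\<Sum>j = 1..<Suc N. 1 / (2 * fact (j - 1))) \<le>
    1 / 2 + (\<Sum>l = 3..N. (real l - 1)\<^sup>2 / fact l) + (real N - 1) / fact N"
  using assms
proof (induction N rule: dec_induct)
  case base
  then show ?case by (simp add: numeral_2_eq_2)
next
  case (step N)
  have "(real (Suc N) - 1)\<^sup>2 / fact (Suc N) + (real (Suc N) - 1) / fact (Suc N)
      = (real N * real (Suc N)) / (real (Suc N) * fact N)"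
    by (simp add: add_divide_distrib[symmetric] power2_eq_square algebra_simps)
  also have "\<dots> = real N / fact N" by simp
  also have "\<dots> = (real N - 1) / fact N + 1 / fact N" by (simp add: diff_divide_distrib)
  finally have "(real (Suc N) - 1)\<^sup>2 / fact (Suc N) + (real (Suc N) - 1) / fact (Suc N)
      = (real N - 1) / fact N + 1 / fact N" .
  moreover have "1 / (2 * fact N) \<le> (1 / fact N :: real)" by (simp add: field_simps)
  ultimately have "(real N - 1) / fact N + 1 / (2 * fact N) \<le>
      (real (Suc N) - 1)\<^sup>2 / fact (Suc N) + (real (Suc N) - 1) / fact (Suc N)" by linarith
  moreover have "(\<Sum>l = 3..Suc N. (real l - 1)\<^sup>2 / fact l) =
      (\<Sum>l = 3..N. (real l - 1)\<^sup>2 / fact l) + (real (Suc N) - 1)\<^sup>2 / fact (Suc N)"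
    using step by (simp add: sum.cl_ivl_Suc)
  moreover have "(\<Sum>j = 1..<Suc (Suc N). 1 / (2 * fact (j - 1))) =
      (\<Sum>j = 1..<Suc N. 1 / (2 * fact (j - 1))) + (1 / (2 * fact N) :: real)"
    by simp
  ultimately show ?case using step.IH by linarith
qed

theorem theorem4p7:
  fixes r :: "nat \<Rightarrow> real" and n :: nat
  assumes r4: "r 4 = 7"
    and r_rec: "\<And>m. m \<ge> 5 \<Longrightarrow>
      r m = r (m - 1) + fact (m - 1) / 2
        + fact (m - 1) * (\<Sum>l = 3..m - 2. (real l - 1)\<^sup>2 / fact l)
        + (real m - 3) * (real m - 1)"
    and n: "n \<ge> 5"
  shows "ereal_of_enat (group_rank (pure_twin_group n)) \<le> ereal (r n)"
proof -
  define g where "g n = (\<Sum>k = 1..<n. \<Sum>j = 1..<k. fact k / (2 * fact (j - 1)) :: real)" for n :: nat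
  have "4 \<le> n" using n by simp
  then have g_le: "g n \<le> r n"
  proof (induction n rule: dec_induct)
    case base
    \<comment> \<open>The contributions are 0 for k = 1, 1 for k = 2 and 3 + 3 for k = 3.\<close>
    have "g 4 = 7" by (simp add: g_def eval_nat_numeral)
    then show ?case by (simp add: r4)
  next
    case (step m)
    \<comment> \<open>This is the upper summation limit in the recurrence at \<open>Suc m\<close>.
      Scaled by m!, the term (N - 1)/N! becomes m (m - 2), the final product of that
      recurrence.\<close>
    define N where "N = m - 1"
    have N: "N \<ge> 2" "m = Suc N" using step by (auto simp: N_def)
    have "g (Suc m) - g m = (\<Sum>j = 1..<m. fact m / (2 * fact (j - 1)))"
      using step by (simp add: g_def)
    also have "\<dots> = fact m * (\<Sum>j = 1..<Suc N. 1 / (2 * fact (j - 1)))"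
      unfolding sum_distrib_left N(2)[symmetric] by simp
    also have "\<dots> \<le> fact m *
        (1 / 2 + (\<Sum>l = 3..N. (real l - 1)\<^sup>2 / fact l) + (real N - 1) / fact N)"
      by (intro mult_left_mono sum_inverse_fact_le N) simp
    also have "\<dots> = fact m / 2 + fact m * (\<Sum>l = 3..N. (real l - 1)\<^sup>2 / fact l)
        + (real (Suc m) - 3) * (real (Suc m) - 1)"
      using N(2) by (simp add: distrib_left) (simp add: algebra_simps)
    also have "\<dots> = r (Suc m) - r m"
      using r_rec[of "Suc m"] step N(2) by simp
    finally show ?case using step.IH by simp
  qed
  obtain S where S: "finite S" "S \<subseteq> carrier (pure_twin_group n)"
    "generate (pure_twin_group n) S = carrier (pure_twin_group n)" "real (card S) \<le> g n"
    using pure_twin_group_generated[of n] n unfolding g_def by auto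
  have "ereal_of_enat (group_rank (pure_twin_group n)) \<le> ereal_of_enat (enat (card S))"
    using group_rank_le_card[OF S(1-3)] by (simp only: ereal_of_enat_le_iff)
  also have "\<dots> \<le> ereal (r n)" using S(4) g_le by simp
  finally show ?thesis .
qed

end
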